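(* Let $g(z)$ be a power series with real coefficients and $g(0)\ne0$, let $a\neq0$ be real, let $\{G_n(s)\}_{n\ge0}$ be the Appell sequence for the pair $(g,az)$, i.e. $\sum_{n\ge0}G_n(s)\frac{z^n}{n!}=g(z)e^{asz}$, and let $\{G_n^c(s)\}_{n\ge0}$ be its cognate sequence, i.e. $\sum_{n\ge0}G_n^c(s)\frac{z^n}{n!}=\frac{a}{g(z)}e^{asz}$. If for every $n\ge1$ all zeros of $G_n(s)$ are symmetric with respect to the line $\operatorname{Re}s=-\frac{g'(0)}{2a}$, then for every $n\ge1$ all zeros of $G_n^c(s)$ are symmetric with respect to the line $\operatorname{Re}s=\frac{g'(0)}{2a}$.
   Context: The zeros of a polynomial are symmetric with respect to the line $\operatorname{Re}s=\kappa$ ($\kappa\in\mathbb{R}$) if the multiset of its complex zeros (counted with multiplicity) is invariant under the reflection $s\mapsto 2\kappa-\overline{s}$. Power series are formal. *)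

theory Defs
  imports "HOL-Computational_Algebra.Computational_Algebra"
begin

(* The generating-function identity sum_n G_n(s) z^n / n! = g(z) exp(a s z) is an identity of
   power series in z whose coefficients are polynomials in s.  It is stated here by evaluating
   at every real s; two real polynomials that agree at all real s are equal, so this is the
   same as the identity over R[s][[z]], and it determines G uniquely from g and a. *)
definition appell_seq :: "real fps \<Rightarrow> real \<Rightarrow> (nat \<Rightarrow> real poly) \<Rightarrow> bool" where
  "appell_seq g a G \<longleftrightarrow>
     (\<forall>s. Abs_fps (\<lambda>n. poly (G n) s / fact n) = g * fps_exp (a * s))"

(* The quotient of formal power series is the genuine a / g(z) when g(0) is nonzero. *)
definition cognate_seq :: "real fps \<Rightarrow> real \<Rightarrow> (nat \<Rightarrow> real poly) \<Rightarrow> bool" where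
  "cognate_seq g a Gc \<longleftrightarrow> appell_seq (fps_const a / g) a Gc"

definition reflect_line :: "real \<Rightarrow> complex \<Rightarrow> complex" where
  "reflect_line \<kappa> s = 2 * of_real \<kappa> - cnj s"

(* proots is the multiset of zeros with multiplicity; by library convention it is empty for the
   zero polynomial, which does not occur among the G_n when g(0) and a are nonzero. *)
definition zeros_symmetric :: "real \<Rightarrow> real poly \<Rightarrow> bool" where
  "zeros_symmetric \<kappa> p \<longleftrightarrow>
     (let Z = proots (map_poly complex_of_real p) in image_mset (reflect_line \<kappa>) Z = Z)"

end

theory Submission
  imports Defs
begin

text \<open>Since \<open>G\<^sub>n\<close> is real of degree \<open>n\<close>, the symmetry of its zeros with respect to \<open>Re s = \<kappa>\<close> says
  that \<open>G\<^sub>n(2\<kappa> - s) = (-1)\<^sup>n G\<^sub>n(s)\<close>.  In terms of the generating function this is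
  \<open>g(z) exp(2a\<kappa>z) = g(-z)\<close>, which for \<open>a/g\<close> becomes the same equation with \<open>-\<kappa>\<close> in place of \<open>\<kappa>\<close>.\<close>

lemma proots_prod_mset_linear_factors:
  fixes A :: "'a :: idom multiset"
  shows "proots (\<Prod>x\<in>#A. [:- x, 1:]) = A"
proof (induction A)
  case (add x A)
  have "(\<Prod>x\<in>#A. [:- x, 1:]) \<noteq> 0"
    by auto
  with add show ?case
    by (simp add: proots_mult del: mult_pCons_left)
qed auto

lemma prod_mset_uminus:
  fixes f :: "'a \<Rightarrow> 'b :: comm_ring_1"
  shows "(\<Prod>x\<in>#A. - f x) = (- 1) ^ size A * (\<Prod>x\<in>#A. f x)"
  by (induction A) auto

lemma cnj_prod_mset: "cnj (\<Prod>x\<in>#A. f x) = (\<Prod>x\<in>#A. cnj (f x))"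
  by (induction A) auto

text \<open>The reflection is antiholomorphic, so composing \<open>P\<close> with it gives no
  polynomial; conjugating the coefficients as well repairs this. The value at \<open>s\<close> is
  then the conjugate of \<open>P\<close> at the reflected point.\<close>

lemma proots_reflect:
  fixes P :: "complex poly"
  assumes "P \<noteq> 0"
  shows "proots (pcompose (map_poly cnj P) [:2 * of_real \<kappa>, - 1:]) =
           image_mset (reflect_line \<kappa>) (proots P)"
proof -
  let ?B = "image_mset (reflect_line \<kappa>) (proots P)"
  let ?c = "(- 1) ^ size (proots P) * cnj (lead_coeff P)"
  have fac: "poly P s = lead_coeff P * (\<Prod>x\<in>#proots P. s - x)" for s
    by (subst complex_poly_decompose_multiset [of P, symmetric])
       (simp add: poly_prod_mset image_mset.compositionality o_def)
  have "poly (pcompose (map_poly cnj P) [:2 * of_real \<kappa>, - 1:]) s =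
          poly (smult ?c (\<Prod>x\<in>#?B. [:- x, 1:])) s" for s
  proof -
    have "poly (pcompose (map_poly cnj P) [:2 * of_real \<kappa>, - 1:]) s =
            cnj (poly P (reflect_line \<kappa> s))"
      by (simp add: poly_pcompose reflect_line_def)
    \<comment> \<open>The conjugate of \<open>reflect_line \<kappa> s - x\<close> is
      \<open>reflect_line \<kappa> x - s\<close>. Making each such factor monic in \<open>s\<close>
      costs one sign per zero, collected in \<open>?c\<close>.\<close>
    also have "\<dots> = cnj (lead_coeff P) * (\<Prod>x\<in>#proots P. - (s - reflect_line \<kappa> x))"
      by (simp add: fac cnj_prod_mset reflect_line_def algebra_simps)
    also have "\<dots> = ?c * (\<Prod>x\<in>#proots P. s - reflect_line \<kappa> x)"
      by (subst prod_mset_uminus) simp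
    finally show ?thesis
      by (simp add: poly_prod_mset image_mset.compositionality o_def)
  qed
  then have "pcompose (map_poly cnj P) [:2 * of_real \<kappa>, - 1:] = smult ?c (\<Prod>x\<in>#?B. [:- x, 1:])"
    by (simp add: poly_eq_poly_eq_iff [symmetric] fun_eq_iff)
  then show ?thesis
    using assms by (simp add: proots_prod_mset_linear_factors del: image_mset.compositionality)
qed

text \<open>Real coefficients absorb the conjugation in \<open>proots_reflect\<close>, so the
  reflection can be carried out on the real polynomial.\<close>

lemma map_poly_of_real_pcompose_reflect:
  "map_poly complex_of_real (pcompose p [:2 * \<kappa>, - 1:]) =
     pcompose (map_poly cnj (map_poly complex_of_real p)) [:2 * of_real \<kappa>, - 1:]"
proof -
  let ?C = "map_poly complex_of_real"
  have add: "?C (q + r) = ?C q + ?C r" for q r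
    by (simp add: poly_eq_iff coeff_map_poly)
  have minus: "?C (- q) = - ?C q" for q
    by (simp add: poly_eq_iff coeff_map_poly)
  have "map_poly cnj (?C p) = ?C p"
    by (simp add: poly_eq_iff coeff_map_poly)
  moreover have "?C (pcompose p [:2 * \<kappa>, - 1:]) = pcompose (?C p) [:2 * of_real \<kappa>, - 1:]"
    by (induction p) (simp_all add: map_poly_pCons pcompose_pCons add minus map_poly_smult)
  ultimately show ?thesis by simp
qed

text \<open>A nonzero complex polynomial is determined by its zeros and its leading coefficient.
  Substituting \<open>2 * \<kappa> - s\<close> reflects the zeros and multiplies the leading
  coefficient by \<open>(- 1) ^ degree p\<close>. For \<open>p = 0\<close> both sides hold.\<close>

lemma zeros_symmetric_iff:
  "zeros_symmetric \<kappa> p \<longleftrightarrow> pcompose p [:2 * \<kappa>, - 1:] = smult ((- 1) ^ degree p) p"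
proof (cases "p = 0")
  case False
  let ?C = "map_poly complex_of_real"
  let ?q = "pcompose p [:2 * \<kappa>, - 1:]"
  have C_nz: "?C p \<noteq> 0"
    using False by (subst map_poly_eq_0_iff) auto
  have lc: "lead_coeff (?C r) = of_real (lead_coeff r)" for r
    by (cases "r = 0") (simp_all add: lead_coeff_map_poly_nz)
  have C_inj: "?C r = ?C r' \<longleftrightarrow> r = r'" for r r'
    by (auto simp: poly_eq_iff coeff_map_poly)
  have "zeros_symmetric \<kappa> p \<longleftrightarrow> proots (?C ?q) = proots (?C p)"
    using proots_reflect [OF C_nz, of \<kappa>]
    by (simp add: zeros_symmetric_def Let_def eq_commute map_poly_of_real_pcompose_reflect)
  also have "\<dots> \<longleftrightarrow> ?C ?q = smult ((- 1) ^ degree p) (?C p)"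
  proof
    assume eq: "proots (?C ?q) = proots (?C p)"
    \<comment> \<open>Equal zeros give the same monic product, so only the leading coefficients
      remain to be compared.\<close>
    have "?C ?q = smult (lead_coeff (?C ?q)) (\<Prod>x\<in>#proots (?C p). [:- x, 1:])"
      by (metis complex_poly_decompose_multiset eq)
    also have "lead_coeff (?C ?q) = (- 1) ^ degree p * lead_coeff (?C p)"
      unfolding lc by (subst lead_coeff_comp) simp_all
    also have "smult \<dots> (\<Prod>x\<in>#proots (?C p). [:- x, 1:]) = smult ((- 1) ^ degree p) (?C p)"
      by (metis complex_poly_decompose_multiset smult_smult)
    finally show "?C ?q = smult ((- 1) ^ degree p) (?C p)" .
  qed simp
  also have "smult ((- 1) ^ degree p) (?C p) = ?C (smult ((- 1) ^ degree p) p)"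
    by (simp add: map_poly_smult)
  finally show ?thesis
    by (simp add: C_inj)
qed (simp add: zeros_symmetric_def)

text \<open>The coefficient of \<open>s ^ n\<close> in \<open>G n\<close> is
  \<open>g(0) * a ^ n\<close>. Knowing the degree turns the sign in
  \<open>zeros_symmetric_iff\<close> into \<open>(- 1) ^ n\<close>, which a generating function can
  encode.\<close>

lemma degree_appell_seq:
  assumes "appell_seq g a G" "fps_nth g 0 \<noteq> 0" "a \<noteq> 0"
  shows "degree (G n) = n"
proof -
  \<comment> \<open>This is \<open>n!\<close> times the coefficient of \<open>z ^ n\<close> in the
    Cauchy product of \<open>g\<close> and \<open>exp(a s z)\<close>, read as a polynomial in
    \<open>s\<close>.\<close>
  let ?H = "smult (fact n) (\<Sum>i=0..n. monom (fps_nth g i * a ^ (n - i) / fact (n - i)) (n - i))"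
  have "poly (G n) s / fact n = (\<Sum>i=0..n. fps_nth g i * (a * s) ^ (n - i) / fact (n - i))" for s
    using arg_cong [where f = "\<lambda>f. fps_nth f n", OF assms(1) [unfolded appell_seq_def, rule_format, of s]]
    by (simp add: fps_mult_nth)
  then have "poly (G n) s = poly ?H s" for s
    by (simp add: poly_sum poly_monom power_mult_distrib field_simps)
  then have G: "G n = ?H"
    by (simp add: poly_eq_poly_eq_iff [symmetric] fun_eq_iff)
  have "coeff (G n) n = (\<Sum>i=0..n. if i = 0 then fps_nth g 0 * a ^ n else 0)"
    unfolding G coeff_smult coeff_sum sum_distrib_left by (intro sum.cong) auto
  then have "n \<le> degree (G n)"
    using assms(2,3) by (intro le_degree) simp
  moreover have "degree (G n) \<le> n"
    unfolding G by (intro order.trans [OF degree_smult_le] degree_sum_le)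
      (auto intro: order.trans [OF degree_monom_le])
  ultimately show ?thesis by simp
qed

text \<open>Replacing \<open>s\<close> by \<open>2 * \<kappa> - s\<close> turns
  \<open>exp(a s z)\<close> into \<open>exp(2 a \<kappa> z) exp(- a s z)\<close>, while the signs
  \<open>(- 1) ^ n\<close> amount to replacing \<open>z\<close> by \<open>-z\<close>. Both sides
  then carry \<open>exp(- a s z)\<close>, and cancelling it leaves an equation free of
  \<open>s\<close>.\<close>

lemma appell_seq_reflect_iff:
  assumes "appell_seq g a G"
  shows "(\<forall>n. pcompose (G n) [:2 * \<kappa>, - 1:] = smult ((- 1) ^ n) (G n)) \<longleftrightarrow>
           g * fps_exp (2 * a * \<kappa>) = fps_compose g (- fps_X)"
proof -
  have G: "Abs_fps (\<lambda>n. poly (G n) s / fact n) = g * fps_exp (a * s)" for s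
    using assms by (simp add: appell_seq_def)
  have 1: "Abs_fps (\<lambda>n. poly (pcompose (G n) [:2 * \<kappa>, - 1:]) s / fact n) =
             g * fps_exp (2 * a * \<kappa>) * fps_exp (- (a * s))" for s
    using G [of "2 * \<kappa> - s"]
    by (simp add: poly_pcompose mult.assoc fps_exp_add_mult [symmetric] algebra_simps)
  have "Abs_fps (\<lambda>n. poly (smult ((- 1) ^ n) (G n)) s / fact n) =
             fps_compose (Abs_fps (\<lambda>n. poly (G n) s / fact n)) (- fps_X)" for s
    by (simp add: fps_eq_iff fps_compose_uminus')
  then have 2: "Abs_fps (\<lambda>n. poly (smult ((- 1) ^ n) (G n)) s / fact n) =
             fps_compose g (- fps_X) * fps_exp (- (a * s))" for s
    unfolding G by (simp add: fps_compose_mult_distrib)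
  have "(\<forall>n. pcompose (G n) [:2 * \<kappa>, - 1:] = smult ((- 1) ^ n) (G n)) \<longleftrightarrow>
          (\<forall>s. Abs_fps (\<lambda>n. poly (pcompose (G n) [:2 * \<kappa>, - 1:]) s / fact n) =
               Abs_fps (\<lambda>n. poly (smult ((- 1) ^ n) (G n)) s / fact n))"
    by (auto simp: poly_eq_poly_eq_iff [symmetric] fun_eq_iff fps_eq_iff simp del: poly_smult)
  also have "\<dots> \<longleftrightarrow> g * fps_exp (2 * a * \<kappa>) = fps_compose g (- fps_X)"
    unfolding 1 2 by simp
  finally show ?thesis .
qed

text \<open>Replacing \<open>z\<close> by \<open>-z\<close> respects products and fixes constants,
  so if it multiplies \<open>g\<close> by \<open>exp(c z)\<close>, it must multiply
  \<open>a / g\<close> by the inverse factor.\<close>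

lemma fps_reflect_divide:
  fixes g :: "'a :: field_char_0 fps"
  assumes "fps_nth g 0 \<noteq> 0" and "g * fps_exp c = fps_compose g (- fps_X)"
  shows "fps_const a / g * fps_exp (- c) = fps_compose (fps_const a / g) (- fps_X)"
proof -
  let ?h = "fps_const a / g"
  have hg: "?h * g = fps_const a"
    using assms(1) by (simp add: fps_divide_unit inverse_mult_eq_1 mult.assoc)
  have "fps_compose ?h (- fps_X) * fps_exp c * g = fps_compose (?h * g) (- fps_X)"
    using assms(2) by (simp add: fps_compose_mult_distrib mult_ac)
  also have "\<dots> = ?h * g"
    by (simp add: hg)
  finally have "?h = fps_compose ?h (- fps_X) * fps_exp c"
    using assms(1) by (metis fps_zero_nth mult_right_cancel)
  then have "?h * fps_exp (- c) = fps_compose ?h (- fps_X) * (fps_exp c * fps_exp (- c))"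
    by (simp add: mult.assoc)
  then show ?thesis
    by (simp add: fps_exp_add_mult [symmetric])
qed

theorem theorem5:
  fixes g :: "real fps" and a :: real and G Gc :: "nat \<Rightarrow> real poly"
  assumes "fps_nth g 0 \<noteq> 0" and "a \<noteq> 0"
    and "appell_seq g a G" and "cognate_seq g a Gc"
    and "\<forall>n\<ge>1. zeros_symmetric (- (fps_nth (fps_deriv g) 0 / (2 * a))) (G n)"
  shows "\<forall>n\<ge>1. zeros_symmetric (fps_nth (fps_deriv g) 0 / (2 * a)) (Gc n)"
proof -
  define \<kappa> where "\<kappa> = - (fps_nth (fps_deriv g) 0 / (2 * a))"
  have deg: "degree (G n) = n" for n
    using assms by (intro degree_appell_seq)
  have cog: "appell_seq (fps_const a / g) a Gc"
    using assms(4) by (simp add: cognate_seq_def)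
  have degc: "degree (Gc n) = n" for n
    using assms(1,2) by (intro degree_appell_seq [OF cog]) (simp_all add: fps_divide_unit)
  have "pcompose (G n) [:2 * \<kappa>, - 1:] = smult ((- 1) ^ n) (G n)" for n
  proof (cases "n = 0")
    case True
    \<comment> \<open>The symmetry hypothesis starts at \<open>n = 1\<close>; \<open>G 0\<close> is
      a constant, which composition leaves unchanged, and its sign is 1.\<close>
    then show ?thesis
      using deg [of 0] by (auto elim: degree_eq_zeroE)
  next
    case False
    then show ?thesis
      using assms(5) deg [of n] by (simp add: zeros_symmetric_iff \<kappa>_def)
  qed
  then have "g * fps_exp (2 * a * \<kappa>) = fps_compose g (- fps_X)"
    using appell_seq_reflect_iff [OF assms(3)] by blast
  then have "fps_const a / g * fps_exp (2 * a * (- \<kappa>)) = fps_compose (fps_const a / g) (- fps_X)"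
    using fps_reflect_divide [OF assms(1)] by simp
  then have "\<forall>n. pcompose (Gc n) [:2 * (- \<kappa>), - 1:] = smult ((- 1) ^ n) (Gc n)"
    using appell_seq_reflect_iff [OF cog] by blast
  then have "zeros_symmetric (- \<kappa>) (Gc n)" for n
    by (simp add: zeros_symmetric_iff degc)
  then show ?thesis
    by (simp add: \<kappa>_def)
qed

end
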